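(* Let $\Omega=\{y\in\mathbb{R}^n: g(y)\le 0,\ h(y)=0\}$, where $g:\mathbb{R}^n\to\mathbb{R}^s$ is a convex function (componentwise) and $h:\mathbb{R}^n\to\mathbb{R}^p$ is an affine function, and let $x\in\Omega$. Consider the propositions: (a) $x$ is a KKT point of the problem of minimizing $f(y)$ subject to $g(y)\le 0$, $h(y)=0$; (b) $x$ is the minimizer of $f$ over $\Omega$; (c) $Q(x)=x$. If $x\neq a^1,\dots,a^m$, $g$ and $h$ are continuously differentiable, and $x$ is a regular point, then (a), (b) and (c) are equivalent. If $x=a^k$ for some $k=1,\dots,m$, then (b) implies (c).
   Context: Throughout, $\|\cdot\|$ and $\langle\cdot,\cdot\rangle$ are the Euclidean norm and inner product on $\mathbb{R}^n$. $a^1,\dots,a^m\in\mathbb{R}^n$ are distinct, non-collinear points (the vertices), $w_1,\dots,w_m>0$ are weights, and $f(x)=\sum_{j=1}^m w_j\|x-a^j\|$. $\Omega\subset\mathbb{R}^n$ is nonempty, closed and convex, with orthogonal projection $P_\Omega:\mathbb{R}^n\to\Omega$. Define, for $x\in\mathbb{R}^n$: - $A(x)=\sum_{j=1}^m\frac{w_j}{2\|x-a^j\|}$ if $x\neq a^1,\dots,a^m$, and $A(a^k)=\sum_{j\neq k}\frac{w_j}{2\|a^k-a^j\|}$. - $\widetilde T(x)=\frac{1}{2A(x)}\sum_{j=1}^m\frac{w_ja^j}{\|x-a^j\|}$ if $x\neq a^1,\dots,a^m$, and $\widetilde T(a^k)=\frac{1}{2A(a^k)}\sum_{j\neq k}\frac{w_ja^j}{\|a^k-a^j\|}$.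 - $\widetilde R(x)=\sum_{j=1}^m\frac{w_j(a^j-x)}{\|x-a^j\|}$ if $x\neq a^1,\dots,a^m$, and $\widetilde R(a^k)=\sum_{j\neq k}\frac{w_j(a^j-a^k)}{\|a^k-a^j\|}$; $r(x)=\|\widetilde R(x)\|$. - $\gamma(x)=0$ if $x\neq a^1,\dots,a^m$; $\gamma(a^k)=0$ if $r(a^k)=0$; $\gamma(a^k)=w_k/r(a^k)$ if $r(a^k)\neq 0$. $\beta(x)=\min\{1,\gamma(x)\}$. - $T(x)=(1-\beta(x))\widetilde T(x)+\beta(x)x$. For $a^k\in\Omega$ let $\lambda(a^k)=\inf\{\lambda\in[0,1]:(1-\lambda)T(a^k)+\lambda a^k\in\Omega\}$. The iteration function $Q:\Omega\to\Omega$ is $Q(x)=P_\Omega(T(x))$ if $x\neq a^1,\dots,a^m$, and $Q(a^k)=(1-\lambda(a^k))T(a^k)+\lambda(a^k)a^k$ if $x=a^k\in\Omega$. KKT point (for $x$ not a vertex, $g,h$ differentiable): $x$ satisfies $g(x)\le0$, $h(x)=0$ and there exist multipliers $\mu_1,\dots,\mu_s\ge 0$ and $\lambda_1,\dots,\lambda_p\in\mathbb{R}$ with $\nabla f(x)+\sum_{j=1}^s\mu_j\nabla g_j(x)+\sum_{j=1}^p\lambda_j\nabla h_j(x)=0$ and $\mu_jg_j(x)=0$ for $j=1,\dots,s$. Regular point: $x\in\Omega$ such that the gradients $\nabla h_j(x)$ ($1\le j\le p$) together with $\nabla g_j(x)$ for all $j$ with $g_j(x)=0$ are linearly independent. *)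

theory Defs
  imports "HOL-Analysis.Analysis"
begin

definition gradient :: "(real ^ 'n \<Rightarrow> real) \<Rightarrow> real ^ 'n \<Rightarrow> real ^ 'n" where
  "gradient \<phi> x = (THE D. GDERIV \<phi> x :> D)"

lemma gradient_eqI:
  assumes "GDERIV \<phi> x :> D"
  shows "gradient \<phi> x = D"
  unfolding gradient_def
proof (rule the_equality)
  fix E assume "GDERIV \<phi> x :> E"
  with assms have "(\<lambda>h. h \<bullet> D) = (\<lambda>h. h \<bullet> E)"
    unfolding gderiv_def by (rule has_derivative_unique)
  then show "E = D" by (metis vector_eq_ldot)
qed (rule assms)

lemma differentiable_imp_gradient:
  assumes "\<phi> differentiable (at x)"
  shows "GDERIV \<phi> x :> gradient \<phi> x"
proof -
  obtain L where L: "(\<phi> has_derivative L) (at x)"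
    using assms by (auto simp: differentiable_def)
  then have lin: "linear L" by (rule has_derivative_linear)
  have "L = (\<lambda>h. h \<bullet> adjoint L 1)"
    using adjoint_works[OF lin] by (auto simp: fun_eq_iff inner_commute)
  then have "GDERIV \<phi> x :> adjoint L 1"
    using L by (simp add: gderiv_def)
  then show ?thesis using gradient_eqI by metis
qed

definition continuously_differentiable :: "(real ^ 'n \<Rightarrow> real) \<Rightarrow> bool" where
  "continuously_differentiable \<phi> \<longleftrightarrow>
     (\<forall>y. \<phi> differentiable (at y)) \<and> continuous_on UNIV (gradient \<phi>)"

definition affine_function :: "(real ^ 'n \<Rightarrow> real) \<Rightarrow> bool" where
  "affine_function \<phi> \<longleftrightarrow> (\<exists>L c. linear L \<and> (\<forall>y. \<phi> y = L y + c))"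

text \<open>The maps \<open>g\<close> into \<open>\<real>\<^sup>s\<close> and \<open>h\<close> into \<open>\<real>\<^sup>p\<close> are given by their component functions
  \<open>g 1, \<dots>, g s\<close> and \<open>h 1, \<dots>, h p\<close>; \<open>s = 0\<close> or \<open>p = 0\<close> means that there are no
  constraints of that kind.\<close>

definition feasible_set ::
  "nat \<Rightarrow> (nat \<Rightarrow> real ^ 'n \<Rightarrow> real) \<Rightarrow> nat \<Rightarrow> (nat \<Rightarrow> real ^ 'n \<Rightarrow> real) \<Rightarrow> (real ^ 'n) set" where
  "feasible_set s g p h = {y. (\<forall>j\<in>{1..s}. g j y \<le> 0) \<and> (\<forall>j\<in>{1..p}. h j y = 0)}"

definition KKT_point ::
  "(real ^ 'n \<Rightarrow> real) \<Rightarrow> nat \<Rightarrow> (nat \<Rightarrow> real ^ 'n \<Rightarrow> real) \<Rightarrow>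
     nat \<Rightarrow> (nat \<Rightarrow> real ^ 'n \<Rightarrow> real) \<Rightarrow> real ^ 'n \<Rightarrow> bool" where
  "KKT_point f s g p h x \<longleftrightarrow>
     x \<in> feasible_set s g p h \<and>
     (\<exists>\<mu> \<nu> :: nat \<Rightarrow> real.
        (\<forall>j\<in>{1..s}. 0 \<le> \<mu> j) \<and>
        gradient f x + (\<Sum>j\<in>{1..s}. \<mu> j *\<^sub>R gradient (g j) x)
          + (\<Sum>j\<in>{1..p}. \<nu> j *\<^sub>R gradient (h j) x) = 0 \<and>
        (\<forall>j\<in>{1..s}. \<mu> j * g j x = 0))"

text \<open>Linear independence of an indexed family, so that a repeated vector makes the family
  dependent; this is why injectivity is required in addition to independence of the range.\<close>

definition independent_family :: "('i \<Rightarrow> real ^ 'n) \<Rightarrow> 'i set \<Rightarrow> bool" where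
  "independent_family v I \<longleftrightarrow> inj_on v I \<and> independent (v ` I)"

definition regular_point ::
  "nat \<Rightarrow> (nat \<Rightarrow> real ^ 'n \<Rightarrow> real) \<Rightarrow> nat \<Rightarrow> (nat \<Rightarrow> real ^ 'n \<Rightarrow> real) \<Rightarrow> real ^ 'n \<Rightarrow> bool" where
  "regular_point s g p h x \<longleftrightarrow>
     x \<in> feasible_set s g p h \<and>
     independent_family
       (case_sum (\<lambda>j. gradient (h j) x) (\<lambda>j. gradient (g j) x))
       ({1..p} <+> {j \<in> {1..s}. g j x = 0})"

text \<open>The vertices are \<open>a 1, \<dots>, a m\<close> with weights \<open>w 1, \<dots>, w m\<close>. All sums below whose
  terms have \<open>norm (x - a j)\<close> as a denominator range over \<open>other_indices m a x\<close>. If \<open>x\<close> is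
  not a vertex, these are all indices; if \<open>x = a k\<close> and the vertices are distinct, these are
  the indices \<open>j \<noteq> k\<close>.\<close>

definition vertices :: "nat \<Rightarrow> (nat \<Rightarrow> real ^ 'n) \<Rightarrow> (real ^ 'n) set" where
  "vertices m a = a ` {1..m}"

definition other_indices :: "nat \<Rightarrow> (nat \<Rightarrow> real ^ 'n) \<Rightarrow> real ^ 'n \<Rightarrow> nat set" where
  "other_indices m a x = {j \<in> {1..m}. a j \<noteq> x}"

definition weber_f :: "nat \<Rightarrow> (nat \<Rightarrow> real ^ 'n) \<Rightarrow> (nat \<Rightarrow> real) \<Rightarrow> real ^ 'n \<Rightarrow> real" where
  "weber_f m a w x = (\<Sum>j\<in>{1..m}. w j * norm (x - a j))"

definition weber_A :: "nat \<Rightarrow> (nat \<Rightarrow> real ^ 'n) \<Rightarrow> (nat \<Rightarrow> real) \<Rightarrow> real ^ 'n \<Rightarrow> real" where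
  "weber_A m a w x = (\<Sum>j\<in>other_indices m a x. w j / (2 * norm (x - a j)))"

definition T_tilde :: "nat \<Rightarrow> (nat \<Rightarrow> real ^ 'n) \<Rightarrow> (nat \<Rightarrow> real) \<Rightarrow> real ^ 'n \<Rightarrow> real ^ 'n" where
  "T_tilde m a w x =
     (1 / (2 * weber_A m a w x)) *\<^sub>R
       (\<Sum>j\<in>other_indices m a x. (w j / norm (x - a j)) *\<^sub>R a j)"

definition R_tilde :: "nat \<Rightarrow> (nat \<Rightarrow> real ^ 'n) \<Rightarrow> (nat \<Rightarrow> real) \<Rightarrow> real ^ 'n \<Rightarrow> real ^ 'n" where
  "R_tilde m a w x = (\<Sum>j\<in>other_indices m a x. (w j / norm (x - a j)) *\<^sub>R (a j - x))"

definition weber_r :: "nat \<Rightarrow> (nat \<Rightarrow> real ^ 'n) \<Rightarrow> (nat \<Rightarrow> real) \<Rightarrow> real ^ 'n \<Rightarrow> real" where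
  "weber_r m a w x = norm (R_tilde m a w x)"

text \<open>For distinct vertices, \<open>the_inv_into {1..m} a (a k) = k\<close>.\<close>

definition weber_gamma :: "nat \<Rightarrow> (nat \<Rightarrow> real ^ 'n) \<Rightarrow> (nat \<Rightarrow> real) \<Rightarrow> real ^ 'n \<Rightarrow> real" where
  "weber_gamma m a w x =
     (if x \<notin> vertices m a then 0
      else if weber_r m a w x = 0 then 0
      else w (the_inv_into {1..m} a x) / weber_r m a w x)"

definition weber_beta :: "nat \<Rightarrow> (nat \<Rightarrow> real ^ 'n) \<Rightarrow> (nat \<Rightarrow> real) \<Rightarrow> real ^ 'n \<Rightarrow> real" where
  "weber_beta m a w x = min 1 (weber_gamma m a w x)"

definition weber_T :: "nat \<Rightarrow> (nat \<Rightarrow> real ^ 'n) \<Rightarrow> (nat \<Rightarrow> real) \<Rightarrow> real ^ 'n \<Rightarrow> real ^ 'n" where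
  "weber_T m a w x =
     (1 - weber_beta m a w x) *\<^sub>R T_tilde m a w x + weber_beta m a w x *\<^sub>R x"

definition weber_lambda ::
  "nat \<Rightarrow> (nat \<Rightarrow> real ^ 'n) \<Rightarrow> (nat \<Rightarrow> real) \<Rightarrow> (real ^ 'n) set \<Rightarrow> real ^ 'n \<Rightarrow> real" where
  "weber_lambda m a w \<Omega> x =
     Inf {l \<in> {0..1}. (1 - l) *\<^sub>R weber_T m a w x + l *\<^sub>R x \<in> \<Omega>}"

definition weber_Q ::
  "nat \<Rightarrow> (nat \<Rightarrow> real ^ 'n) \<Rightarrow> (nat \<Rightarrow> real) \<Rightarrow> (real ^ 'n) set \<Rightarrow> real ^ 'n \<Rightarrow> real ^ 'n" where
  "weber_Q m a w \<Omega> x =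
     (if x \<in> vertices m a
      then (1 - weber_lambda m a w \<Omega> x) *\<^sub>R weber_T m a w x + weber_lambda m a w \<Omega> x *\<^sub>R x
      else closest_point \<Omega> (weber_T m a w x))"

text \<open>A minimizer of \<open>weber_f m a w\<close> over a convex set is unique, so being a minimizer (in the
  sense of \<^const>\<open>is_arg_min\<close>) is the same as being the minimizer.\<close>

lemma weber_minimizer_unique:
  fixes a :: "nat \<Rightarrow> real ^ 'n"
  assumes nc: "\<not> collinear (vertices m a)"
    and w: "\<And>j. j \<in> {1..m} \<Longrightarrow> 0 < w j"
    and S: "convex S"
    and x: "is_arg_min (weber_f m a w) (\<lambda>y. y \<in> S) x"
    and y: "is_arg_min (weber_f m a w) (\<lambda>y. y \<in> S) y"
  shows "x = y"
proof (rule ccontr)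
  assume ne: "x \<noteq> y"
  define z where "z = (1/2) *\<^sub>R x + (1/2) *\<^sub>R y"
  have xy: "x \<in> S" "y \<in> S" using x y by (auto simp: is_arg_min_def)
  have zS: "z \<in> S" unfolding z_def using S xy by (intro convexD) auto
  have fz: "weber_f m a w x \<le> weber_f m a w z" "weber_f m a w y \<le> weber_f m a w z"
    using x y zS by (auto simp: is_arg_min_def not_less)
  have half: "z - a j = (1/2) *\<^sub>R ((x - a j) + (y - a j))" for j
    by (simp add: z_def vec_eq_iff field_simps)
  have nz: "norm (z - a j) = norm ((x - a j) + (y - a j)) / 2" for j
    by (simp add: half)
  define d where "d j = w j * ((norm (x - a j) + norm (y - a j)) / 2 - norm (z - a j))" for j
  have dge: "0 \<le> d j" if "j \<in> {1..m}" for j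
    using w[OF that] norm_triangle_ineq[of "x - a j" "y - a j"] by (simp add: d_def nz)
  have "(\<Sum>j\<in>{1..m}. d j)
      = weber_f m a w x / 2 + weber_f m a w y / 2 - weber_f m a w z"
    by (simp add: d_def weber_f_def sum_divide_distrib flip: sum.distrib sum_subtractf)
       (simp add: field_simps)
  also have "\<dots> \<le> 0" using fz by simp
  finally have "(\<Sum>j\<in>{1..m}. d j) = 0" using dge by (intro antisym sum_nonneg) auto
  then have d0: "d j = 0" if "j \<in> {1..m}" for j
    using that dge sum_nonneg_eq_0_iff[of "{1..m}" d] by auto
  have col: "collinear {x, y, a j}" if j: "j \<in> {1..m}" for j
  proof -
    have "norm ((x - a j) + (y - a j)) = norm (x - a j) + norm (y - a j)"
      using d0[OF j] w[OF j] by (simp add: d_def nz)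
    then have "collinear {0, x - a j, y - a j}"
      by (rule norm_triangle_eq_imp_collinear)
    then have "collinear {x, a j, y}"
      by (subst collinear_3) (auto simp: NO_MATCH_def)
    then show ?thesis by (simp add: insert_commute)
  qed
  have "vertices m a \<subseteq> affine hull {x, y}"
    using col ne by (auto simp: vertices_def collinear_3_affine_hull)
  then show False using nc collinear_affine_hull by blast
qed

end

theory Submission
  imports Defs
begin

text \<open>
  All three propositions are translated into one variational inequality. Near a point \<open>x\<close> the
  objective splits into the terms whose vertex differs from \<open>x\<close>, which are differentiable at \<open>x\<close>
  with gradient \<open>- R_tilde x\<close>, and, if \<open>x = a k\<close>, the conical term \<open>w k * norm (y - x)\<close>. Write \<open>c\<close>
  for \<open>w k\<close> in that case and for \<open>0\<close> if \<open>x\<close> is not a vertex. Then \<open>x\<close> minimizes the objective over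
  a convex set \<open>S\<close> iff \<open>R_tilde x \<bullet> (y - x) \<le> c * norm (y - x)\<close> for all \<open>y \<in> S\<close>
  (\<open>weber_minimizer_iff_variational_inequality\<close>): one direction is a one-sided derivative along
  the segment from \<open>x\<close> to \<open>y\<close>, the other the subgradient inequality.

  (b) and (c). The Weiszfeld step is a rescaled gradient step: \<open>T x - x\<close> is
  \<open>(1 - \<beta> x) / (2 A x)\<close> times \<open>R_tilde x\<close>. Off the vertices \<open>\<beta> x = 0\<close>, so the factor is positive,
  and the obtuse-angle characterization of the projection turns \<open>Q x = x\<close> into the variational
  inequality. At a vertex \<open>a k\<close> the step vanishes unless \<open>w k < r (a k)\<close>; in that case \<open>R_tilde\<close> is a
  direction that violates the inequality, so at a minimizer no proper part of the step stays in
  the feasible set. Hence \<open>\<lambda> = 1\<close>, and \<open>Q\<close> does not move.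

  (a) and (b). Off the vertices the variational inequality says that the gradient of the objective
  is nonnegative on all \<open>y - x\<close> with \<open>y\<close> feasible. Convexity of \<open>g\<close> and affinity of \<open>h\<close> derive it
  from the multiplier equation. Conversely, at a regular point every direction along which the
  active \<open>g j\<close> strictly decrease and the \<open>h j\<close> are constant is feasible for a short step, and
  independence of the gradients provides enough such directions to express the negative gradient
  by multipliers of the right sign (\<open>independent_family_multipliers\<close>).
\<close>

section \<open>First-order facts along lines\<close>

lemma gderiv_along_line:
  fixes \<phi> :: "real ^ 'n \<Rightarrow> real"
  assumes "GDERIV \<phi> x :> D"
  shows "((\<lambda>t. \<phi> (x + t *\<^sub>R v)) has_real_derivative v \<bullet> D) (at 0)"
proof -
  have "(\<phi> has_derivative (\<lambda>h. h \<bullet> D)) (at (x + 0 *\<^sub>R v))"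
    using assms by (simp add: gderiv_def)
  moreover have "((\<lambda>t. x + t *\<^sub>R v) has_derivative (\<lambda>t. t *\<^sub>R v)) (at (0::real))"
    by (auto intro!: derivative_eq_intros)
  ultimately have "((\<lambda>t. \<phi> (x + t *\<^sub>R v)) has_derivative (\<lambda>t. (t *\<^sub>R v) \<bullet> D)) (at 0)"
    by (rule has_derivative_compose[rotated])
  then show ?thesis
    by (simp add: has_field_derivative_def mult.commute[of _ "v \<bullet> D"])
qed

lemma convex_on_gradient_inequality:
  fixes \<phi> :: "real ^ 'n \<Rightarrow> real"
  assumes cvx: "convex_on UNIV \<phi>" and D: "GDERIV \<phi> x :> D"
  shows "(y - x) \<bullet> D \<le> \<phi> y - \<phi> x"
proof (rule ccontr)
  assume neg: "\<not> ?thesis"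
  define \<psi> where "\<psi> t = \<phi> (x + t *\<^sub>R (y - x)) - t * (\<phi> y - \<phi> x)" for t
  have "(\<psi> has_real_derivative (y - x) \<bullet> D - (\<phi> y - \<phi> x)) (at 0)"
    unfolding \<psi>_def by (auto intro!: derivative_eq_intros gderiv_along_line[OF D])
  from DERIV_pos_inc_right[OF this] neg
  obtain e where e: "e > 0" "\<And>t. 0 < t \<Longrightarrow> t < e \<Longrightarrow> \<psi> 0 < \<psi> t" by auto
  define t where "t = min (1/2) (e/2)"
  have t: "0 < t" "t < e" "t \<le> 1" using e(1) by (auto simp: t_def)
  have "\<phi> ((1 - t) *\<^sub>R x + t *\<^sub>R y) \<le> (1 - t) * \<phi> x + t * \<phi> y"
    using cvx t by (intro convex_onD) auto
  moreover have "(1 - t) *\<^sub>R x + t *\<^sub>R y = x + t *\<^sub>R (y - x)"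
    by (simp add: algebra_simps)
  ultimately have "\<psi> t \<le> \<psi> 0" by (simp add: \<psi>_def algebra_simps)
  with e(2)[OF t(1,2)] show False by simp
qed

lemma affine_function_gradient:
  assumes "affine_function \<phi>"
  shows "\<phi> y - \<phi> x = (y - x) \<bullet> gradient \<phi> x"
proof -
  obtain L c where L: "linear L" "\<And>y. \<phi> y = L y + c"
    using assms by (auto simp: affine_function_def)
  have "(\<phi> has_derivative L) (at x)"
    unfolding L(2) by (rule derivative_eq_intros linear_imp_has_derivative[OF L(1)] | simp)+
  moreover from this have "(\<phi> has_derivative (\<lambda>h. h \<bullet> gradient \<phi> x)) (at x)"
    using differentiable_imp_gradient[of \<phi> x] by (auto simp: gderiv_def differentiable_def)
  ultimately have "L = (\<lambda>h. h \<bullet> gradient \<phi> x)" by (rule has_derivative_unique)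
  then have "L (y - x) = (y - x) \<bullet> gradient \<phi> x" by (rule fun_cong)
  then show ?thesis using L(2)[of x] L(2)[of y] linear_diff[OF L(1), of y x] by simp
qed

section \<open>Convex feasible sets and projections\<close>

lemma convex_feasible_set:
  fixes g h :: "nat \<Rightarrow> real ^ 'n \<Rightarrow> real"
  assumes g: "\<And>j. j \<in> {1..s} \<Longrightarrow> convex_on UNIV (g j)"
    and h: "\<And>j. j \<in> {1..p} \<Longrightarrow> affine_function (h j)"
  shows "convex (feasible_set s g p h)"
proof (rule convexI)
  fix x y :: "real ^ 'n" and u v :: real
  assume xy: "x \<in> feasible_set s g p h" "y \<in> feasible_set s g p h"
    and uv: "0 \<le> u" "0 \<le> v" "u + v = 1"
  have "g j (u *\<^sub>R x + v *\<^sub>R y) \<le> 0" if j: "j \<in> {1..s}" for j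
  proof -
    have "g j (u *\<^sub>R x + v *\<^sub>R y) \<le> u * g j x + v * g j y"
      using g[OF j] uv by (simp add: convex_on_def)
    also have "\<dots> \<le> 0"
      using xy j uv by (intro add_nonpos_nonpos mult_nonneg_nonpos) (auto simp: feasible_set_def)
    finally show ?thesis .
  qed
  moreover have "h j (u *\<^sub>R x + v *\<^sub>R y) = 0" if j: "j \<in> {1..p}" for j
  proof -
    have "u *\<^sub>R x + v *\<^sub>R y - x = v *\<^sub>R (y - x)"
    proof -
      have "u = 1 - v" using uv by simp
      then show ?thesis by (simp only:) (simp add: algebra_simps)
    qed
    then have "h j (u *\<^sub>R x + v *\<^sub>R y) - h j x = v * (h j y - h j x)"
      using affine_function_gradient[OF h[OF j], of _ x] by simp
    then show ?thesis using xy j by (simp add: feasible_set_def)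
  qed
  ultimately show "u *\<^sub>R x + v *\<^sub>R y \<in> feasible_set s g p h"
    by (simp add: feasible_set_def)
qed

lemma closed_feasible_set:
  assumes g: "\<And>j. j \<in> {1..s} \<Longrightarrow> continuous_on UNIV (g j)"
    and h: "\<And>j. j \<in> {1..p} \<Longrightarrow> continuous_on UNIV (h j)"
  shows "closed (feasible_set s g p h)"
proof -
  have "feasible_set s g p h
      = (\<Inter>j\<in>{1..s}. {y. g j y \<le> 0}) \<inter> (\<Inter>j\<in>{1..p}. {y. h j y = 0})"
    by (auto simp: feasible_set_def)
  moreover have "closed {y. g j y \<le> 0}" if "j \<in> {1..s}" for j
    using g[OF that] by (intro closed_Collect_le) auto
  moreover have "closed {y. h j y = 0}" if "j \<in> {1..p}" for j
    using h[OF that] by (intro closed_Collect_eq) auto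
  ultimately show ?thesis by (auto intro!: closed_Int closed_INT)
qed

text \<open>The obtuse-angle criterion. Expanding \<open>norm (z - y)\<^sup>2\<close> around \<open>x\<close> shows that a nonpositive
  inner product can only increase the distance to \<open>z\<close>.\<close>

lemma closest_point_eq_iff:
  fixes x z :: "real ^ 'n"
  assumes S: "convex S" "closed S" and x: "x \<in> S"
  shows "closest_point S z = x \<longleftrightarrow> (\<forall>y\<in>S. (z - x) \<bullet> (y - x) \<le> 0)"
proof
  assume "closest_point S z = x"
  then show "\<forall>y\<in>S. (z - x) \<bullet> (y - x) \<le> 0"
    using closest_point_dot[OF S] by blast
next
  assume obtuse: "\<forall>y\<in>S. (z - x) \<bullet> (y - x) \<le> 0"
  have "dist z x \<le> dist z y" if y: "y \<in> S" for y
  proof -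
    have "(z - y) \<bullet> (z - y)
        = (z - x) \<bullet> (z - x) - 2 * ((z - x) \<bullet> (y - x)) + (y - x) \<bullet> (y - x)"
      by (simp add: inner_diff inner_commute algebra_simps)
    then have "(z - x) \<bullet> (z - x) \<le> (z - y) \<bullet> (z - y)"
      using obtuse y by (smt (verit) inner_ge_zero)
    then show ?thesis by (simp add: dist_norm norm_le)
  qed
  then show "closest_point S z = x"
    using closest_point_unique[OF S x] by metis
qed

section \<open>The variational inequality for the Weber function\<close>

text \<open>Here \<open>x\<close> is the point at which the objective is to be expanded and \<open>y\<close> is the argument; only
  the terms that are differentiable at \<open>x\<close> are kept.\<close>

definition smooth_part ::
  "nat \<Rightarrow> (nat \<Rightarrow> real ^ 'n) \<Rightarrow> (nat \<Rightarrow> real) \<Rightarrow> real ^ 'n \<Rightarrow> real ^ 'n \<Rightarrow> real" where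
  "smooth_part m a w x y = (\<Sum>j\<in>other_indices m a x. w j * norm (y - a j))"

text \<open>The slope of the conical term at \<open>x\<close>. A sum over the indices that hit \<open>x\<close> treats vertices and
  other points alike.\<close>

definition vertex_weight ::
  "nat \<Rightarrow> (nat \<Rightarrow> real ^ 'n) \<Rightarrow> (nat \<Rightarrow> real) \<Rightarrow> real ^ 'n \<Rightarrow> real" where
  "vertex_weight m a w x = (\<Sum>j\<in>{j \<in> {1..m}. a j = x}. w j)"

lemma vertex_weight_nonvertex:
  assumes "x \<notin> vertices m a"
  shows "vertex_weight m a w x = 0"
proof -
  have "{j \<in> {1..m}. a j = x} = {}" using assms unfolding vertices_def by blast
  then show ?thesis by (simp only: vertex_weight_def sum.empty)
qed

lemma vertex_weight_vertex:
  assumes "inj_on a {1..m}" "k \<in> {1..m}"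
  shows "vertex_weight m a w (a k) = w k"
proof -
  have "{j \<in> {1..m}. a j = a k} = {k}"
    using inj_onD[OF assms(1)] assms(2) by blast
  then show ?thesis by (simp only: vertex_weight_def) simp
qed

lemma weber_f_split:
  "weber_f m a w y = smooth_part m a w x y + vertex_weight m a w x * norm (y - x)"
proof -
  let ?V = "{j \<in> {1..m}. a j = x}"
  have "{1..m} = other_indices m a x \<union> ?V"
    unfolding other_indices_def by blast
  then have "weber_f m a w y = (\<Sum>j\<in>other_indices m a x \<union> ?V. w j * norm (y - a j))"
    by (simp only: weber_f_def)
  also have "\<dots> = smooth_part m a w x y + (\<Sum>j\<in>?V. w j * norm (y - a j))"
    unfolding smooth_part_def
    by (rule sum.union_disjoint) (auto simp: other_indices_def)
  also have "(\<Sum>j\<in>?V. w j * norm (y - a j)) = (\<Sum>j\<in>?V. w j * norm (y - x))"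
    by (rule sum.cong) auto
  also have "\<dots> = vertex_weight m a w x * norm (y - x)"
    by (simp only: vertex_weight_def sum_distrib_right)
  finally show ?thesis .
qed

lemma gderiv_smooth_part: "GDERIV (smooth_part m a w x) x :> - R_tilde m a w x"
proof -
  have "((\<lambda>y. w j * norm (y - a j)) has_derivative
      (\<lambda>h. h \<bullet> (- ((w j / norm (x - a j)) *\<^sub>R (a j - x))))) (at x)"
    if j: "j \<in> other_indices m a x" for j
  proof -
    have "x - a j \<noteq> 0" using j by (auto simp: other_indices_def)
    from GDERIV_norm[OF this]
    have "(norm has_derivative (\<lambda>h. h \<bullet> sgn (x - a j))) (at (x - a j))"
      by (simp add: gderiv_def)
    moreover have "((\<lambda>y. y - a j) has_derivative (\<lambda>h. h)) (at x)"
      by (auto intro!: derivative_eq_intros)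
    ultimately have "((\<lambda>y. norm (y - a j)) has_derivative (\<lambda>h. h \<bullet> sgn (x - a j))) (at x)"
      by (rule has_derivative_compose[rotated])
    then have "((\<lambda>y. w j * norm (y - a j)) has_derivative
        (\<lambda>h. w j * (h \<bullet> sgn (x - a j)))) (at x)"
      by (rule has_derivative_mult_right)
    then show ?thesis
      by (simp add: sgn_div_norm inner_diff_right divide_inverse algebra_simps)
  qed
  from has_derivative_sum[OF this]
  show ?thesis
    unfolding gderiv_def smooth_part_def R_tilde_def
    by (simp only: inner_sum_right flip: sum_negf)
qed

lemma gradient_weber_f:
  assumes "x \<notin> vertices m a"
  shows "gradient (weber_f m a w) x = - R_tilde m a w x"
proof -
  have "weber_f m a w = smooth_part m a w x"
    using weber_f_split[of m a w _ x] assms by (auto simp: vertex_weight_nonvertex)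
  then show ?thesis using gradient_eqI[OF gderiv_smooth_part[of m a w x]] by simp
qed

text \<open>Each term is the Cauchy-Schwarz inequality for \<open>x - a j\<close> and \<open>y - a j\<close>, divided by
  \<open>norm (x - a j)\<close>.\<close>

lemma smooth_part_subgradient:
  assumes w: "\<And>j. j \<in> {1..m} \<Longrightarrow> 0 < w j"
  shows "smooth_part m a w x x - R_tilde m a w x \<bullet> (y - x) \<le> smooth_part m a w x y"
proof -
  have "w j * norm (x - a j) - ((w j / norm (x - a j)) *\<^sub>R (a j - x)) \<bullet> (y - x)
      \<le> w j * norm (y - a j)" if j: "j \<in> other_indices m a x" for j
  proof -
    let ?u = "x - a j"
    have u: "norm ?u > 0" and wj: "w j > 0" using j w by (auto simp: other_indices_def)
    have "?u \<bullet> (y - a j) \<le> norm ?u * norm (y - a j)" by (rule norm_cauchy_schwarz)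
    moreover have "?u \<bullet> (y - a j) = norm ?u * norm ?u - (a j - x) \<bullet> (y - x)"
    proof -
      have "y - a j = ?u + (y - x)" "a j - x = - ?u" by simp_all
      then show ?thesis
        by (simp only: inner_add_right inner_minus_left flip: norm_eq_sqrt_inner)
           (simp add: dot_square_norm power2_eq_square)
    qed
    ultimately have "norm ?u - ((a j - x) \<bullet> (y - x)) / norm ?u \<le> norm (y - a j)"
      using u by (simp add: field_simps)
    then have "w j * (norm ?u - ((a j - x) \<bullet> (y - x)) / norm ?u) \<le> w j * norm (y - a j)"
      using wj by simp
    then show ?thesis by (simp add: right_diff_distrib)
  qed
  from sum_mono[OF this] show ?thesis
    by (simp add: smooth_part_def R_tilde_def inner_sum_left sum_subtractf)
qed

text \<open>The first-order optimality condition. It is sufficient because the right-hand side bounds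
  exactly the part of the objective that is not differentiable at \<open>x\<close>, and necessary because a
  violation would make the objective decrease along the segment from \<open>x\<close> towards \<open>y\<close>, which lies
  in \<open>S\<close>.\<close>

lemma weber_minimizer_iff_variational_inequality:
  assumes w: "\<And>j. j \<in> {1..m} \<Longrightarrow> 0 < w j"
    and S: "convex S" and x: "x \<in> S"
  shows "is_arg_min (weber_f m a w) (\<lambda>y. y \<in> S) x \<longleftrightarrow>
    (\<forall>y\<in>S. R_tilde m a w x \<bullet> (y - x) \<le> vertex_weight m a w x * norm (y - x))"
proof
  assume min: "is_arg_min (weber_f m a w) (\<lambda>y. y \<in> S) x"
  show "\<forall>y\<in>S. R_tilde m a w x \<bullet> (y - x) \<le> vertex_weight m a w x * norm (y - x)"
  proof (rule ballI, rule ccontr)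
    fix y assume y: "y \<in> S"
      and viol: "\<not> R_tilde m a w x \<bullet> (y - x) \<le> vertex_weight m a w x * norm (y - x)"
    \<comment> \<open>For \<open>t \<ge> 0\<close> this is the objective at \<open>x + t (y - x)\<close>; it is differentiable at \<open>0\<close>
      because the norm of the vertex term has been replaced by a linear function of \<open>t\<close>.\<close>
    define \<psi> where "\<psi> t = smooth_part m a w x (x + t *\<^sub>R (y - x))
        + t * (vertex_weight m a w x * norm (y - x))" for t
    have "(\<psi> has_real_derivative (y - x) \<bullet> (- R_tilde m a w x)
        + vertex_weight m a w x * norm (y - x)) (at 0)"
      unfolding \<psi>_def
      by (auto intro!: derivative_eq_intros gderiv_along_line[OF gderiv_smooth_part] simp del: inner_minus_right)
    from DERIV_neg_dec_right[OF this] viol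
    obtain e where e: "e > 0" "\<And>t. 0 < t \<Longrightarrow> t < e \<Longrightarrow> \<psi> t < \<psi> 0"
      by (auto simp: inner_commute)
    define t where "t = min (1/2) (e/2)"
    have t: "0 < t" "t < e" "t \<le> 1" using e(1) by (auto simp: t_def)
    have "(1 - t) *\<^sub>R x + t *\<^sub>R y \<in> S" using S x y t by (intro convexD) auto
    moreover have "(1 - t) *\<^sub>R x + t *\<^sub>R y = x + t *\<^sub>R (y - x)" by (simp add: algebra_simps)
    ultimately have "weber_f m a w x \<le> weber_f m a w (x + t *\<^sub>R (y - x))"
      using min by (auto simp: is_arg_min_def not_less)
    moreover have "weber_f m a w (x + t *\<^sub>R (y - x)) = \<psi> t"
      using t by (simp add: weber_f_split[where x = x] \<psi>_def)
    moreover have "weber_f m a w x = \<psi> 0"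
      by (simp add: weber_f_split[where x = x] \<psi>_def)
    ultimately show False using e(2)[OF t(1,2)] by simp
  qed
next
  assume VI: "\<forall>y\<in>S. R_tilde m a w x \<bullet> (y - x) \<le> vertex_weight m a w x * norm (y - x)"
  have "weber_f m a w x \<le> weber_f m a w y" if y: "y \<in> S" for y
    using bspec[OF VI y] smooth_part_subgradient[of m w a x y, OF w]
    by (simp add: weber_f_split[where x = x])
  then show "is_arg_min (weber_f m a w) (\<lambda>y. y \<in> S) x"
    using x by (auto simp: is_arg_min_def not_less)
qed

section \<open>The Weiszfeld step\<close>

text \<open>Non-collinearity rules out that all vertices coincide with \<open>x\<close>, so at least one term
  remains in the sum.\<close>

lemma weber_A_pos:
  assumes nc: "\<not> collinear (vertices m a)"
    and w: "\<And>j. j \<in> {1..m} \<Longrightarrow> 0 < w j"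
  shows "0 < weber_A m a w x"
proof -
  have "\<not> vertices m a \<subseteq> {x}"
    using nc collinear_subset[OF collinear_sing, of _ x] by blast
  then have "other_indices m a x \<noteq> {}"
    by (auto simp: vertices_def other_indices_def)
  then show ?thesis
    unfolding weber_A_def using w by (intro sum_pos) (auto simp: other_indices_def)
qed

text \<open>\<open>T_tilde\<close> is the weighted average of the vertices with weights \<open>w j / norm (x - a j)\<close>, whose
  total is \<open>2 * weber_A m a w x\<close>; the same weights define \<open>R_tilde\<close>.\<close>

lemma T_tilde_diff:
  assumes A: "weber_A m a w x \<noteq> 0"
  shows "T_tilde m a w x - x = (1 / (2 * weber_A m a w x)) *\<^sub>R R_tilde m a w x"
proof -
  have "2 * weber_A m a w x = (\<Sum>j\<in>other_indices m a x. w j / norm (x - a j))"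
    by (auto simp: weber_A_def sum_distrib_left intro!: sum.cong)
  then have "R_tilde m a w x
      = (\<Sum>j\<in>other_indices m a x. (w j / norm (x - a j)) *\<^sub>R a j) - (2 * weber_A m a w x) *\<^sub>R x"
    by (simp add: R_tilde_def scaleR_diff_right sum_subtractf scaleR_sum_left)
  then show ?thesis using A by (simp add: T_tilde_def scaleR_diff_right)
qed

lemma weber_T_diff:
  assumes "weber_A m a w x \<noteq> 0"
  shows "weber_T m a w x - x
    = ((1 - weber_beta m a w x) / (2 * weber_A m a w x)) *\<^sub>R R_tilde m a w x"
proof -
  have "weber_T m a w x - x = (1 - weber_beta m a w x) *\<^sub>R (T_tilde m a w x - x)"
    by (simp add: weber_T_def algebra_simps)
  then show ?thesis by (simp add: T_tilde_diff[OF assms])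
qed

lemma weber_minimizer_iff_fixed_point:
  assumes nc: "\<not> collinear (vertices m a)"
    and w: "\<And>j. j \<in> {1..m} \<Longrightarrow> 0 < w j"
    and S: "convex S" "closed S" and x: "x \<in> S" "x \<notin> vertices m a"
  shows "is_arg_min (weber_f m a w) (\<lambda>y. y \<in> S) x \<longleftrightarrow> weber_Q m a w S x = x"
proof -
  have A: "0 < weber_A m a w x" using nc w by (rule weber_A_pos)
  have "weber_beta m a w x = 0"
    using x(2) by (simp add: weber_beta_def weber_gamma_def)
  then have "(weber_T m a w x - x) \<bullet> (y - x) \<le> 0 \<longleftrightarrow> R_tilde m a w x \<bullet> (y - x) \<le> 0" for y
    using A by (simp add: weber_T_diff divide_le_0_iff)
  moreover have "is_arg_min (weber_f m a w) (\<lambda>y. y \<in> S) x \<longleftrightarrow>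
      (\<forall>y\<in>S. R_tilde m a w x \<bullet> (y - x) \<le> vertex_weight m a w x * norm (y - x))"
    using w S(1) x(1) by (rule weber_minimizer_iff_variational_inequality)
  ultimately show ?thesis
    using x by (simp add: weber_Q_def closest_point_eq_iff[OF S x(1)] vertex_weight_nonvertex)
qed

lemma weber_lambda_eq_1:
  assumes "x \<in> S"
    and "\<And>t. 0 < t \<Longrightarrow> t \<le> 1 \<Longrightarrow> x + t *\<^sub>R (weber_T m a w x - x) \<notin> S"
  shows "weber_lambda m a w S x = 1"
proof -
  have "{l \<in> {0..1}. (1 - l) *\<^sub>R weber_T m a w x + l *\<^sub>R x \<in> S} = {1}"
  proof safe
    fix l :: real assume l: "l \<in> {0..1}" "(1 - l) *\<^sub>R weber_T m a w x + l *\<^sub>R x \<in> S"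
    have "(1 - l) *\<^sub>R weber_T m a w x + l *\<^sub>R x = x + (1 - l) *\<^sub>R (weber_T m a w x - x)"
      by (simp add: algebra_simps)
    then show "l = 1" using assms(2)[of "1 - l"] l by fastforce
  qed (use assms(1) in auto)
  then show ?thesis by (simp add: weber_lambda_def)
qed

text \<open>If the step is nonzero, then \<open>w k < norm R\<close> with \<open>R = R_tilde m a w (a k)\<close>. Moving by
  \<open>q *\<^sub>R R\<close> with \<open>q > 0\<close> then violates the variational inequality, since
  \<open>q * (norm R)\<^sup>2 > q * w k * norm R\<close>. So the feasible set contains no point of the step other than
  \<open>a k\<close> itself.\<close>

lemma weber_minimizer_vertex_fixed_point:
  assumes inj: "inj_on a {1..m}"
    and nc: "\<not> collinear (vertices m a)"
    and w: "\<And>j. j \<in> {1..m} \<Longrightarrow> 0 < w j"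
    and S: "convex S" and k: "k \<in> {1..m}"
    and min: "is_arg_min (weber_f m a w) (\<lambda>y. y \<in> S) (a k)"
  shows "weber_Q m a w S (a k) = a k"
proof -
  let ?x = "a k" and ?R = "R_tilde m a w (a k)" and ?r = "weber_r m a w (a k)"
  define c where "c = (1 - weber_beta m a w ?x) / (2 * weber_A m a w ?x)"
  have x: "?x \<in> S" using min by (simp add: is_arg_min_def)
  have V: "?x \<in> vertices m a" using k by (auto simp: vertices_def)
  have A: "0 < weber_A m a w ?x" using nc w by (rule weber_A_pos)
  have step: "weber_T m a w ?x - ?x = c *\<^sub>R ?R"
    using A by (simp add: weber_T_diff c_def)
  have "is_arg_min (weber_f m a w) (\<lambda>y. y \<in> S) ?x \<longleftrightarrow>
      (\<forall>y\<in>S. ?R \<bullet> (y - ?x) \<le> vertex_weight m a w ?x * norm (y - ?x))"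
    using w S x by (rule weber_minimizer_iff_variational_inequality)
  then have VI: "?R \<bullet> (y - ?x) \<le> w k * norm (y - ?x)" if "y \<in> S" for y
    using min that by (simp add: vertex_weight_vertex[OF inj k])
  show ?thesis
  proof (cases "weber_T m a w ?x = ?x")
    case True
    then show ?thesis using V by (simp add: weber_Q_def)
  next
    case False
    then have R: "?R \<noteq> 0" and c: "c \<noteq> 0" using step by auto
    have r: "?r > 0" using R by (simp add: weber_r_def)
    have gamma: "weber_gamma m a w ?x = w k / ?r"
      using V r inj k by (simp add: weber_gamma_def the_inv_into_f_f)
    have "weber_beta m a w ?x \<noteq> 1" using c by (auto simp: c_def)
    then have "w k / ?r < 1" by (auto simp: weber_beta_def gamma min_def split: if_splits)
    then have wr: "w k < ?r" using r by simp
    have c_pos: "c > 0"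
      using \<open>w k / ?r < 1\<close> A by (simp add: c_def weber_beta_def gamma min_def)
    have "weber_lambda m a w S ?x = 1"
    proof (rule weber_lambda_eq_1[OF x], rule notI)
      fix t :: real
      assume t: "0 < t" "t \<le> 1" and "?x + t *\<^sub>R (weber_T m a w ?x - ?x) \<in> S"
      from VI[OF this(3)] have "(t * c) * ?r\<^sup>2 \<le> (t * c) * (w k * ?r)"
        using t c_pos by (simp add: step weber_r_def power2_norm_eq_inner algebra_simps abs_mult)
      then have "?r * ?r \<le> w k * ?r"
        using t c_pos by (simp add: power2_eq_square)
      then show False using wr r by simp
    qed
    then show ?thesis using V by (simp add: weber_Q_def)
  qed
qed

section \<open>Multipliers at a regular point\<close>

text \<open>The vectors of an independent family can be given arbitrary values by a linear functional, and
  this functional is an inner product. This supplies both strictly decreasing directions and a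
  dual basis.\<close>

lemma independent_family_interpolation:
  fixes v :: "'i \<Rightarrow> real ^ 'n"
  assumes "independent_family v I"
  obtains z where "\<And>i. i \<in> I \<Longrightarrow> v i \<bullet> z = c i"
proof -
  have inj: "inj_on v I" and ind: "independent (v ` I)"
    using assms by (auto simp: independent_family_def)
  obtain L :: "real ^ 'n \<Rightarrow> real" where L: "linear L"
    and Lv: "\<And>u. u \<in> v ` I \<Longrightarrow> L u = c (the_inv_into I v u)"
    using linear_independent_extend[OF ind, of "\<lambda>u. c (the_inv_into I v u)"] by blast
  have "v i \<bullet> adjoint L 1 = c i" if "i \<in> I" for i
    using adjoint_works[OF L, of "v i" 1] Lv[of "v i"] that inj
    by (simp add: the_inv_into_f_f inner_commute)
  then show ?thesis by (rule that)
qed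

text \<open>Farkas' lemma for an independent family, by way of a dual basis. The hypothesis speaks
  of strict decrease on \<open>J\<close> because only such directions are easily seen to be feasible;
  adding a small multiple of a strictly decreasing \<open>v0\<close> and passing to the limit extends
  it to weak decrease. The component \<open>z\<close> of \<open>d\<close> orthogonal to the span vanishes because \<open>- z\<close> is
  then an admissible direction. The coefficients of \<open>d\<close> on \<open>J\<close> have the right sign because the
  negatives of the dual basis vectors are admissible as well.\<close>

lemma independent_family_multipliers:
  fixes u :: "'i \<Rightarrow> real ^ 'n"
  assumes fin: "finite I" and J: "J \<subseteq> I" and ind: "independent_family u I"
    and dir: "\<And>v. (\<And>i. i \<in> I - J \<Longrightarrow> u i \<bullet> v = 0) \<Longrightarrow> (\<And>i. i \<in> J \<Longrightarrow> u i \<bullet> v < 0)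
      \<Longrightarrow> 0 \<le> d \<bullet> v"
  obtains c where "d + (\<Sum>i\<in>I. c i *\<^sub>R u i) = 0" "\<And>i. i \<in> J \<Longrightarrow> 0 \<le> c i"
proof -
  \<comment> \<open>a Slater-type direction for the linearized constraints\<close>
  obtain v0 where v0: "\<And>i. i \<in> I \<Longrightarrow> u i \<bullet> v0 = (if i \<in> J then -1 else 0)"
    using independent_family_interpolation[OF ind, of "\<lambda>i. if i \<in> J then -1 else 0"] by blast
  have weak: "0 \<le> d \<bullet> v"
    if v: "\<And>i. i \<in> I - J \<Longrightarrow> u i \<bullet> v = 0" "\<And>i. i \<in> J \<Longrightarrow> u i \<bullet> v \<le> 0" for v
  proof -
    have "0 \<le> d \<bullet> (v + e *\<^sub>R v0)" if e: "e > 0" for e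
    proof (rule dir)
      show "u i \<bullet> (v + e *\<^sub>R v0) = 0" if "i \<in> I - J" for i
        using that v v0[of i] by (simp add: inner_add_right)
      show "u i \<bullet> (v + e *\<^sub>R v0) < 0" if "i \<in> J" for i
        using that J e v(2)[of i] v0[of i] by (auto simp: inner_add_right)
    qed
    then have "\<forall>\<^sub>F e in at_right 0. 0 \<le> d \<bullet> (v + e *\<^sub>R v0)"
      by (auto simp: eventually_at_filter)
    moreover have "((\<lambda>e. d \<bullet> (v + e *\<^sub>R v0)) \<longlongrightarrow> d \<bullet> (v + 0 *\<^sub>R v0)) (at_right 0)"
      by (intro tendsto_intros)
    ultimately have "0 \<le> d \<bullet> (v + 0 *\<^sub>R v0)"
      by (intro tendsto_lowerbound[OF _ _ trivial_limit_at_right_real])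
    then show ?thesis by simp
  qed
  have "d \<in> span (u ` I)"
  proof -
    obtain y z where y: "y \<in> span (u ` I)" and z: "\<And>q. q \<in> span (u ` I) \<Longrightarrow> orthogonal z q"
      and d: "d = y + z"
      using orthogonal_subspace_decomp_exists[of "u ` I" d] by blast
    have uz: "u i \<bullet> z = 0" if "i \<in> I" for i
      using z[of "u i"] that by (auto simp: orthogonal_def inner_commute span_base)
    have "0 \<le> d \<bullet> (- z)" by (rule weak) (use uz J in auto)
    moreover have "d \<bullet> z = z \<bullet> z"
      using z[OF y] by (simp add: d inner_add_left inner_add_right orthogonal_def inner_commute)
    ultimately have "z \<bullet> z \<le> 0" by simp
    then have "z = 0" by (metis inner_eq_zero_iff inner_ge_zero order_antisym)
    then show ?thesis using d y by simp
  qed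
  then obtain b where "d = (\<Sum>v\<in>u ` I. b v *\<^sub>R v)"
    using span_finite[of "u ` I"] fin by auto
  then have db: "d = (\<Sum>i\<in>I. b (u i) *\<^sub>R u i)"
    using ind by (simp add: sum.reindex independent_family_def)
  show ?thesis
  proof (rule that[of "\<lambda>i. - b (u i)"])
    show "d + (\<Sum>i\<in>I. (- b (u i)) *\<^sub>R u i) = 0"
      by (subst db) (simp add: sum_negf)
    show "0 \<le> - b (u j)" if j: "j \<in> J" for j
    proof -
      obtain v where v: "\<And>i. i \<in> I \<Longrightarrow> u i \<bullet> v = (if i = j then -1 else 0)"
        using independent_family_interpolation[OF ind, of "\<lambda>i. if i = j then -1 else 0"] by blast
      have "0 \<le> d \<bullet> v" by (rule weak) (use v J j in auto)
      also have "d \<bullet> v = (\<Sum>i\<in>I. b (u i) * (u i \<bullet> v))"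
        by (subst db) (simp add: inner_sum_left)
      also have "\<dots> = (\<Sum>i\<in>I. if i = j then - b (u i) else 0)"
        using v by (intro sum.cong) auto
      also have "\<dots> = - b (u j)" using fin j J by (auto simp: sum.delta)
      finally show ?thesis .
    qed
  qed
qed

text \<open>Along \<open>v\<close> the active inequalities become strict by their negative derivative, the inactive
  ones persist by continuity, and the affine equalities hold exactly. There are finitely many
  inequalities, so one step length serves all.\<close>

lemma feasible_direction:
  assumes x: "x \<in> feasible_set s g p h"
    and gd: "\<And>j. j \<in> {1..s} \<Longrightarrow> g j differentiable (at x)"
    and h: "\<And>j. j \<in> {1..p} \<Longrightarrow> affine_function (h j)"
    and gv: "\<And>j. j \<in> {1..s} \<Longrightarrow> g j x = 0 \<Longrightarrow> v \<bullet> gradient (g j) x < 0"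
    and hv: "\<And>j. j \<in> {1..p} \<Longrightarrow> v \<bullet> gradient (h j) x = 0"
  shows "\<exists>t>0. x + t *\<^sub>R v \<in> feasible_set s g p h"
proof -
  have "\<forall>\<^sub>F t in at_right 0. g j (x + t *\<^sub>R v) \<le> 0" if j: "j \<in> {1..s}" for j
  proof -
    have der: "((\<lambda>t. g j (x + t *\<^sub>R v)) has_real_derivative v \<bullet> gradient (g j) x) (at 0)"
      by (rule gderiv_along_line[OF differentiable_imp_gradient[OF gd[OF j]]])
    consider "g j x = 0" | "g j x < 0" using x j by (force simp: feasible_set_def)
    then show ?thesis
    proof cases
      case 1
      from DERIV_neg_dec_right[OF der gv[OF j 1]]
      obtain e where "e > 0" "\<And>t. 0 < t \<Longrightarrow> t < e \<Longrightarrow> g j (x + t *\<^sub>R v) < g j x" by auto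
      then show ?thesis using 1 unfolding eventually_at_right_field
        by (metis less_imp_le)
    next
      case 2
      have "((\<lambda>t. g j (x + t *\<^sub>R v)) \<longlongrightarrow> g j x) (at_right 0)"
        using DERIV_isCont[OF der] unfolding isCont_def
        by (auto intro: tendsto_within_subset)
      from order_tendstoD(2)[OF this 2] show ?thesis by eventually_elim simp
    qed
  qed
  then have "\<forall>\<^sub>F t in at_right 0. \<forall>j\<in>{1..s}. g j (x + t *\<^sub>R v) \<le> 0"
    by (intro eventually_ball_finite) auto
  moreover have "\<forall>\<^sub>F t in at_right (0::real). 0 < t"
    by (rule eventually_at_right_less)
  ultimately have "\<forall>\<^sub>F t in at_right 0. 0 < t \<and> (\<forall>j\<in>{1..s}. g j (x + t *\<^sub>R v) \<le> 0)"
    by eventually_elim simp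
  then obtain t where t: "0 < t" "\<forall>j\<in>{1..s}. g j (x + t *\<^sub>R v) \<le> 0"
    using eventually_happens'[OF trivial_limit_at_right_real[of "0::real"]] by blast
  have "h j (x + t *\<^sub>R v) = 0" if j: "j \<in> {1..p}" for j
    using affine_function_gradient[OF h[OF j], of "x + t *\<^sub>R v" x] hv[OF j] x j
    by (simp add: feasible_set_def)
  then show ?thesis using t by (auto simp: feasible_set_def)
qed

text \<open>Multipliers are needed for the active constraints only; the inactive ones get \<open>0\<close>, which is
  complementary slackness.\<close>

lemma regular_point_multipliers:
  assumes reg: "regular_point s g p h x"
    and gd: "\<And>j. j \<in> {1..s} \<Longrightarrow> g j differentiable (at x)"
    and h: "\<And>j. j \<in> {1..p} \<Longrightarrow> affine_function (h j)"
    and VI: "\<And>y. y \<in> feasible_set s g p h \<Longrightarrow> 0 \<le> d \<bullet> (y - x)"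
  obtains \<mu> \<nu> where "\<And>j. j \<in> {1..s} \<Longrightarrow> 0 \<le> \<mu> j"
    "d + (\<Sum>j\<in>{1..s}. \<mu> j *\<^sub>R gradient (g j) x) + (\<Sum>j\<in>{1..p}. \<nu> j *\<^sub>R gradient (h j) x) = 0"
    "\<And>j. j \<in> {1..s} \<Longrightarrow> \<mu> j * g j x = 0"
proof -
  define Act where "Act = {j \<in> {1..s}. g j x = 0}"
  define u where "u = case_sum (\<lambda>j. gradient (h j) x) (\<lambda>j. gradient (g j) x)"
  have x: "x \<in> feasible_set s g p h" and ind: "independent_family u ({1..p} <+> Act)"
    using reg by (auto simp: regular_point_def Act_def u_def)
  have dir: "0 \<le> d \<bullet> v"
    if hv: "\<And>i. i \<in> ({1..p} <+> Act) - Inr ` Act \<Longrightarrow> u i \<bullet> v = 0"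
      and gv: "\<And>i. i \<in> Inr ` Act \<Longrightarrow> u i \<bullet> v < 0" for v
  proof -
    have "v \<bullet> gradient (h j) x = 0" if j: "j \<in> {1..p}" for j
      using hv[OF DiffI[OF InlI[OF j]]]
      by (auto simp: u_def inner_commute)
    moreover have "v \<bullet> gradient (g j) x < 0" if j: "j \<in> {1..s}" "g j x = 0" for j
      using gv[of "Inr j"] j
      by (auto simp: u_def inner_commute Act_def)
    ultimately obtain t where "t > 0" "x + t *\<^sub>R v \<in> feasible_set s g p h"
      using feasible_direction[where s = s and g = g and p = p and h = h and v = v, OF x gd h] by blast
    with VI[of "x + t *\<^sub>R v"] show ?thesis by (simp add: zero_le_mult_iff)
  qed
  have fin: "finite ({1..p} <+> Act)" and sub: "Inr ` Act \<subseteq> {1..p} <+> Act"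
    by (auto simp: Act_def)
  obtain c where c: "d + (\<Sum>i\<in>{1..p} <+> Act. c i *\<^sub>R u i) = 0"
      "\<And>i. i \<in> Inr ` Act \<Longrightarrow> 0 \<le> c i"
  proof (rule independent_family_multipliers[OF fin sub ind])
    show "0 \<le> d \<bullet> v"
      if "\<And>i. i \<in> ({1..p} <+> Act) - Inr ` Act \<Longrightarrow> u i \<bullet> v = 0"
        and "\<And>i. i \<in> Inr ` Act \<Longrightarrow> u i \<bullet> v < 0" for v
      using that by (rule dir)
  qed (rule that)
  define \<mu> where "\<mu> j = (if j \<in> Act then c (Inr j) else 0)" for j
  have "(\<Sum>i\<in>{1..p} <+> Act. c i *\<^sub>R u i)
      = (\<Sum>j\<in>{1..p}. c (Inl j) *\<^sub>R gradient (h j) x) + (\<Sum>j\<in>Act. c (Inr j) *\<^sub>R gradient (g j) x)"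
    by (subst sum.Plus) (auto simp: Act_def u_def)
  also have "(\<Sum>j\<in>Act. c (Inr j) *\<^sub>R gradient (g j) x) = (\<Sum>j\<in>{1..s}. \<mu> j *\<^sub>R gradient (g j) x)"
    by (rule sum.mono_neutral_cong_left) (auto simp: Act_def \<mu>_def)
  finally have stationary: "d + (\<Sum>j\<in>{1..s}. \<mu> j *\<^sub>R gradient (g j) x)
      + (\<Sum>j\<in>{1..p}. c (Inl j) *\<^sub>R gradient (h j) x) = 0"
    using c(1) by (simp add: algebra_simps)
  have nonneg: "0 \<le> \<mu> j" if "j \<in> {1..s}" for j
    using c(2)[of "Inr j"] by (auto simp: \<mu>_def)
  have compl: "\<mu> j * g j x = 0" if "j \<in> {1..s}" for j
    by (auto simp: \<mu>_def Act_def)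
  from nonneg stationary compl show ?thesis by (rule that)
qed

text \<open>Taking the inner product of the multiplier equation with \<open>y - x\<close>, the equality constraints drop out,
  and each inequality constraint contributes at most \<open>\<mu> j * (g j y - g j x) = \<mu> j * g j y \<le> 0\<close> by
  convexity and complementary slackness.\<close>

lemma multipliers_imp_variational_inequality:
  assumes x: "x \<in> feasible_set s g p h" and y: "y \<in> feasible_set s g p h"
    and g: "\<And>j. j \<in> {1..s} \<Longrightarrow> convex_on UNIV (g j)"
    and gd: "\<And>j. j \<in> {1..s} \<Longrightarrow> g j differentiable (at x)"
    and h: "\<And>j. j \<in> {1..p} \<Longrightarrow> affine_function (h j)"
    and mu: "\<And>j. j \<in> {1..s} \<Longrightarrow> 0 \<le> \<mu> j"
    and eq: "d + (\<Sum>j\<in>{1..s}. \<mu> j *\<^sub>R gradient (g j) x)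
      + (\<Sum>j\<in>{1..p}. \<nu> j *\<^sub>R gradient (h j) x) = 0"
    and compl: "\<And>j. j \<in> {1..s} \<Longrightarrow> \<mu> j * g j x = 0"
  shows "0 \<le> d \<bullet> (y - x)"
proof -
  have gs: "\<mu> j * (gradient (g j) x \<bullet> (y - x)) \<le> 0" if j: "j \<in> {1..s}" for j
  proof -
    have "\<mu> j * ((y - x) \<bullet> gradient (g j) x) \<le> \<mu> j * (g j y - g j x)"
      using convex_on_gradient_inequality[OF g[OF j] differentiable_imp_gradient[OF gd[OF j]]] mu[OF j]
      by (rule mult_left_mono)
    also have "\<dots> = \<mu> j * g j y" using compl[OF j] by (simp add: right_diff_distrib)
    also have "\<dots> \<le> 0" using mu[OF j] y j by (auto simp: feasible_set_def mult_nonneg_nonpos)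
    finally show ?thesis by (simp add: inner_commute)
  qed
  have hs: "gradient (h j) x \<bullet> (y - x) = 0" if j: "j \<in> {1..p}" for j
    using affine_function_gradient[OF h[OF j], of y x] x y j
    by (simp add: feasible_set_def inner_commute)
  have "d \<bullet> (y - x) + (\<Sum>j\<in>{1..s}. \<mu> j * (gradient (g j) x \<bullet> (y - x)))
      + (\<Sum>j\<in>{1..p}. \<nu> j * (gradient (h j) x \<bullet> (y - x))) = 0"
    using arg_cong[OF eq, of "\<lambda>z. z \<bullet> (y - x)"] by (simp add: inner_add_left inner_sum_left)
  moreover have "(\<Sum>j\<in>{1..s}. \<mu> j * (gradient (g j) x \<bullet> (y - x))) \<le> 0"
    using gs by (intro sum_nonpos)
  moreover have "(\<Sum>j\<in>{1..p}. \<nu> j * (gradient (h j) x \<bullet> (y - x))) = 0"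
    using hs by (intro sum.neutral) auto
  ultimately show ?thesis by simp
qed

lemma KKT_point_iff_variational_inequality:
  assumes reg: "regular_point s g p h x"
    and g: "\<And>j. j \<in> {1..s} \<Longrightarrow> convex_on UNIV (g j)"
    and gd: "\<And>j. j \<in> {1..s} \<Longrightarrow> g j differentiable (at x)"
    and h: "\<And>j. j \<in> {1..p} \<Longrightarrow> affine_function (h j)"
  shows "KKT_point f s g p h x \<longleftrightarrow> (\<forall>y\<in>feasible_set s g p h. 0 \<le> gradient f x \<bullet> (y - x))"
proof
  assume "KKT_point f s g p h x"
  then obtain \<mu> \<nu> where x: "x \<in> feasible_set s g p h"
    and mult: "\<And>j. j \<in> {1..s} \<Longrightarrow> 0 \<le> \<mu> j"
      "gradient f x + (\<Sum>j\<in>{1..s}. \<mu> j *\<^sub>R gradient (g j) x)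
        + (\<Sum>j\<in>{1..p}. \<nu> j *\<^sub>R gradient (h j) x) = 0"
      "\<And>j. j \<in> {1..s} \<Longrightarrow> \<mu> j * g j x = 0"
    unfolding KKT_point_def by blast
  show "\<forall>y\<in>feasible_set s g p h. 0 \<le> gradient f x \<bullet> (y - x)"
    by (rule ballI, rule multipliers_imp_variational_inequality[where s = s and g = g and p = p
          and h = h and \<mu> = \<mu> and \<nu> = \<nu>, OF x _ g gd h mult])
next
  assume "\<forall>y\<in>feasible_set s g p h. 0 \<le> gradient f x \<bullet> (y - x)"
  then obtain \<mu> \<nu> where "\<And>j. j \<in> {1..s} \<Longrightarrow> 0 \<le> \<mu> j"
    "gradient f x + (\<Sum>j\<in>{1..s}. \<mu> j *\<^sub>R gradient (g j) x)
      + (\<Sum>j\<in>{1..p}. \<nu> j *\<^sub>R gradient (h j) x) = 0"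
    "\<And>j. j \<in> {1..s} \<Longrightarrow> \<mu> j * g j x = 0"
    using regular_point_multipliers[where d = "gradient f x", OF reg gd h] by blast
  then show "KKT_point f s g p h x"
    using reg unfolding KKT_point_def regular_point_def by blast
qed

section \<open>Optimality, KKT points and fixed points\<close>

theorem theorem21:
  fixes a :: "nat \<Rightarrow> real ^ 'n"
    and w :: "nat \<Rightarrow> real"
    and m s p :: nat
    and g h :: "nat \<Rightarrow> real ^ 'n \<Rightarrow> real"
    and \<Omega> :: "(real ^ 'n) set"
    and x :: "real ^ 'n"
  assumes "inj_on a {1..m}"
    and "\<not> collinear (vertices m a)"
    and "\<And>j. j \<in> {1..m} \<Longrightarrow> 0 < w j"
    and "\<And>j. j \<in> {1..s} \<Longrightarrow> convex_on UNIV (g j)"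
    and "\<And>j. j \<in> {1..p} \<Longrightarrow> affine_function (h j)"
    and "\<Omega> = feasible_set s g p h"
    and "x \<in> \<Omega>"
  shows
    "(x \<notin> vertices m a \<and>
      (\<forall>j\<in>{1..s}. continuously_differentiable (g j)) \<and>
      (\<forall>j\<in>{1..p}. continuously_differentiable (h j)) \<and>
      regular_point s g p h x \<longrightarrow>
        (KKT_point (weber_f m a w) s g p h x \<longleftrightarrow>
           is_arg_min (weber_f m a w) (\<lambda>y. y \<in> \<Omega>) x) \<and>
        (is_arg_min (weber_f m a w) (\<lambda>y. y \<in> \<Omega>) x \<longleftrightarrow> weber_Q m a w \<Omega> x = x)) \<and>
     (\<forall>k\<in>{1..m}. x = a k \<longrightarrow>
        is_arg_min (weber_f m a w) (\<lambda>y. y \<in> \<Omega>) x \<longrightarrow> weber_Q m a w \<Omega> x = x)"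
proof (intro conjI impI ballI, goal_cases)
  note inj = assms(1) and nc = assms(2) and w = assms(3) and g = assms(4) and h = assms(5)
    and Omega = assms(6) and x = assms(7)
  have conv: "convex \<Omega>" unfolding Omega using g h by (rule convex_feasible_set)
  {
    case 1
    then have nv: "x \<notin> vertices m a" and reg: "regular_point s g p h x"
      and gd: "\<And>j. j \<in> {1..s} \<Longrightarrow> g j differentiable (at x)"
      by (auto simp: continuously_differentiable_def)
    have "KKT_point (weber_f m a w) s g p h x \<longleftrightarrow>
        (\<forall>y\<in>\<Omega>. 0 \<le> gradient (weber_f m a w) x \<bullet> (y - x))"
      unfolding Omega using reg g gd h by (rule KKT_point_iff_variational_inequality)
    moreover have "is_arg_min (weber_f m a w) (\<lambda>y. y \<in> \<Omega>) x \<longleftrightarrow>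
        (\<forall>y\<in>\<Omega>. R_tilde m a w x \<bullet> (y - x) \<le> vertex_weight m a w x * norm (y - x))"
      using w conv x by (rule weber_minimizer_iff_variational_inequality)
    ultimately show ?case
      using nv by (simp add: vertex_weight_nonvertex gradient_weber_f)
  next
    case 2
    then have nv: "x \<notin> vertices m a" by simp
    from 2 have "closed \<Omega>"
      unfolding Omega
      by (intro closed_feasible_set continuous_at_imp_continuous_on)
        (auto simp: continuously_differentiable_def intro: differentiable_imp_continuous_within)
    with nc w conv show ?case using x nv by (rule weber_minimizer_iff_fixed_point)
  next
    case (3 k)
    then have "is_arg_min (weber_f m a w) (\<lambda>y. y \<in> \<Omega>) (a k)" by simp
    with inj nc w conv 3(1) have "weber_Q m a w \<Omega> (a k) = a k"
      by (rule weber_minimizer_vertex_fixed_point)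
    then show ?case using 3(2) by simp
  }
qed

end
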